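(* There is a constant $C>0$ such that for all $n\in\mathbb{N}$, $Z_{DP}(n) \geq n^2/4 - Cn$; that is, $Z_{DP}(n) \geq n^2/4 - O(n)$.
   Context: All graphs are finite, undirected and simple; $\chi(G)$ is the chromatic number. For a graph $G$ and $s \in \mathbb{N}$, $\mathcal{J}(G,s)$ denotes the join of $G$ with a copy of $K_s$: the graph obtained from $G$ by adding $s$ new vertices adjacent to every vertex of $G$ and to each other. A cover of a graph $G$ is a pair $(L,H)$, where $H$ is a graph and $L\colon V(G)\to 2^{V(H)}$, such that: the sets $L(u)$, $u\in V(G)$, partition $V(H)$; if $u,v\in V(G)$ and some vertex of $L(v)$ is adjacent in $H$ to some vertex of $L(u)$, then $v=u$ or $uv\in E(G)$; each $H[L(u)]$ is a complete graph; and if $uv\in E(G)$, then the set of edges of $H$ between $L(u)$ and $L(v)$ is a matching (possibly empty). An $(L,H)$-coloring of $G$ is an independent set $I$ of $H$ with $|I\cap L(u)|=1$ for all $u\in V(G)$. The DP-chromatic number $\chi_{DP}(G)$ is the smallest $k$ such that $G$ is $(L,H)$-colorable for every cover $(L,H)$ with $|L(u)|\ge k$ for all $u$. $Z_{DP}(G) := \min\{ s\in \mathbb{N} : \chi_{DP}(\mathcal{J}(G,s)) = \chi(\mathcal{J}(G,s))\}$, and $Z_{DP}(n) := \max\{Z_{DP}(G) : G \text{ a graph with } |V(G)|=n\}$. *)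

theory Defs
  imports Complex_Main "HOL-Library.Disjoint_Sets" "Graph_Theory.Pair_Digraph"
begin

text \<open>
  Finite simple graphs are the \<open>pair_graph\<close>s of \<open>Graph_Theory\<close>: a finite vertex set \<open>pverts G\<close> and a
  symmetric irreflexive adjacency relation \<open>parcs G\<close> on it (each edge is a pair of opposite arcs).
\<close>

definition proper_coloring :: "'a pair_pre_digraph \<Rightarrow> nat \<Rightarrow> ('a \<Rightarrow> nat) \<Rightarrow> bool" where
  "proper_coloring G k c \<longleftrightarrow>
     (\<forall>v\<in>pverts G. c v < k) \<and> (\<forall>(u, v)\<in>parcs G. c u \<noteq> c v)"

definition chromatic_number :: "'a pair_pre_digraph \<Rightarrow> nat" where
  "chromatic_number G = (LEAST k. \<exists>c. proper_coloring G k c)"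

text \<open>The join of \<open>G\<close> with \<open>K\<^sub>s\<close>; the new vertices are \<open>Inr i\<close> with \<open>i < s\<close>.\<close>

definition join_complete :: "'a pair_pre_digraph \<Rightarrow> nat \<Rightarrow> ('a + nat) pair_pre_digraph" where
  "join_complete G s =
     \<lparr> pverts = Inl ` pverts G \<union> Inr ` {..<s},
       parcs = {(Inl u, Inl v) | u v. (u, v) \<in> parcs G}
             \<union> {(Inl u, Inr i) | u i. u \<in> pverts G \<and> i < s}
             \<union> {(Inr i, Inl u) | u i. u \<in> pverts G \<and> i < s}
             \<union> {(Inr i, Inr j) | i j. i < s \<and> j < s \<and> i \<noteq> j} \<rparr>"

text \<open>
  The parts \<open>L u\<close> are allowed to be empty. The values of \<open>L\<close> outside \<open>pverts G\<close> play no role.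
  In the matching condition, \<open>(u, v)\<close> ranges over both orientations of each edge, so every vertex
  of \<open>L u\<close> has at most one neighbour in \<open>L v\<close> and vice versa.
\<close>

definition is_cover ::
    "'a pair_pre_digraph \<Rightarrow> ('a \<Rightarrow> 'b set) \<Rightarrow> 'b pair_pre_digraph \<Rightarrow> bool" where
  "is_cover G L H \<longleftrightarrow>
     pair_graph H \<and>
     disjoint_family_on L (pverts G) \<and> (\<Union>u\<in>pverts G. L u) = pverts H \<and>
     (\<forall>u\<in>pverts G. \<forall>v\<in>pverts G.
        (\<exists>x\<in>L u. \<exists>y\<in>L v. (x, y) \<in> parcs H) \<longrightarrow> v = u \<or> (u, v) \<in> parcs G) \<and>
     (\<forall>u\<in>pverts G. \<forall>x\<in>L u. \<forall>y\<in>L u. x \<noteq> y \<longrightarrow> (x, y) \<in> parcs H) \<and>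
     (\<forall>(u, v)\<in>parcs G. \<forall>x\<in>L u. \<forall>y\<in>L v. \<forall>z\<in>L v.
        (x, y) \<in> parcs H \<longrightarrow> (x, z) \<in> parcs H \<longrightarrow> y = z)"

definition independent_set :: "'b pair_pre_digraph \<Rightarrow> 'b set \<Rightarrow> bool" where
  "independent_set H I \<longleftrightarrow> I \<subseteq> pverts H \<and> (\<forall>x\<in>I. \<forall>y\<in>I. (x, y) \<notin> parcs H)"

definition cover_coloring ::
    "'a pair_pre_digraph \<Rightarrow> ('a \<Rightarrow> 'b set) \<Rightarrow> 'b pair_pre_digraph \<Rightarrow> 'b set \<Rightarrow> bool" where
  "cover_coloring G L H I \<longleftrightarrow> independent_set H I \<and> (\<forall>u\<in>pverts G. card (I \<inter> L u) = 1)"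

text \<open>
  Cover graphs are finite, so it suffices to let \<open>H\<close> range over graphs with vertices in \<open>nat\<close>;
  \<open>dp_colorable_cover\<close> below extends this to covers on an arbitrary vertex type.
\<close>

definition dp_colorable :: "'a pair_pre_digraph \<Rightarrow> nat \<Rightarrow> bool" where
  "dp_colorable G k \<longleftrightarrow>
     (\<forall>(L :: 'a \<Rightarrow> nat set) H.
        is_cover G L H \<and> (\<forall>u\<in>pverts G. k \<le> card (L u)) \<longrightarrow> (\<exists>I. cover_coloring G L H I))"

definition dp_chromatic_number :: "'a pair_pre_digraph \<Rightarrow> nat" where
  "dp_chromatic_number G = (LEAST k. dp_colorable G k)"

definition Z_DP :: "'a pair_pre_digraph \<Rightarrow> nat" where
  "Z_DP G = (LEAST s. dp_chromatic_number (join_complete G s) = chromatic_number (join_complete G s))"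

text \<open>Up to isomorphism, every graph on \<open>n\<close> vertices has its vertices in \<open>nat\<close>.\<close>

definition Z_DP_max :: "nat \<Rightarrow> nat" where
  "Z_DP_max n = Max {Z_DP G | G :: nat pair_pre_digraph. pair_graph G \<and> card (pverts G) = n}"

lemma pair_graphI:
  assumes "finite (pverts G)" "parcs G \<subseteq> pverts G \<times> pverts G"
    and "\<And>u v. (u, v) \<in> parcs G \<Longrightarrow> (v, u) \<in> parcs G"
    and "\<And>u. (u, u) \<notin> parcs G"
  shows "pair_graph G"
proof unfold_locales
  show "finite (parcs G)" by (rule finite_subset[OF assms(2)]) (use assms(1) in simp)
  show "symmetric (with_proj G)"
    using assms(3) unfolding symmetric_def by (intro symI) simp
  show "fst e \<in> pverts G" "snd e \<in> pverts G" "fst e \<noteq> snd e" if "e \<in> parcs G" for e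
    using assms(2,4) that by (cases e; auto)+
qed (fact assms(1))

lemma pair_graph_join_complete:
  assumes "pair_graph G"
  shows "pair_graph (join_complete G s)"
proof -
  interpret pair_graph G by fact
  show ?thesis
  proof (rule pair_graphI)
    show "(v, u) \<in> parcs (join_complete G s)" if "(u, v) \<in> parcs (join_complete G s)" for u v
      using that by (auto simp: join_complete_def intro: arcs_symmetric)
  qed (auto simp: join_complete_def dest: in_arcsD1 in_arcsD2 no_loops')
qed

lemma dp_colorable_cover:
  fixes L :: "'a \<Rightarrow> 'b set" and H :: "'b pair_pre_digraph"
  assumes dp: "dp_colorable G k" and cov: "is_cover G L H"
    and k: "\<forall>u\<in>pverts G. k \<le> card (L u)"
    and G: "pair_graph G"
  shows "\<exists>I. cover_coloring G L H I"
proof -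
  interpret H: pair_graph H using cov by (simp add: is_cover_def)
  interpret G: pair_graph G by fact
  obtain f :: "'b \<Rightarrow> nat" where f: "inj_on f (pverts H)"
    using finite_imp_inj_to_nat_seg[OF H.pair_finite_verts] by auto
  define H' where "H' = \<lparr>pverts = f ` pverts H, parcs = (\<lambda>(x, y). (f x, f y)) ` parcs H\<rparr>"
  define L' where "L' u = f ` L u" for u
  have LH: "L u \<subseteq> pverts H" if "u \<in> pverts G" for u
    using cov that by (auto simp: is_cover_def)
  have arc: "(f x, f y) \<in> parcs H' \<longleftrightarrow> (x, y) \<in> parcs H"
    if "x \<in> pverts H" "y \<in> pverts H" for x y
  proof
    assume "(f x, f y) \<in> parcs H'"
    then obtain x' y' where xy: "(x', y') \<in> parcs H" "f x' = f x" "f y' = f y"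
      by (auto simp: H'_def)
    then have "x' = x" "y' = y"
      using f that H.in_arcsD1[OF xy(1)] H.in_arcsD2[OF xy(1)] by (auto simp: inj_on_def)
    with xy show "(x, y) \<in> parcs H" by simp
  qed (auto simp: H'_def intro: rev_image_eqI)
  have arc': "(f x, f y) \<in> parcs H' \<longleftrightarrow> (x, y) \<in> parcs H"
    if "x \<in> L u" "y \<in> L v" "u \<in> pverts G" "v \<in> pverts G" for x y u v
    using arc LH that by blast
  have gr: "pair_graph H'"
  proof (rule pair_graphI)
    show "(v, u) \<in> parcs H'" if "(u, v) \<in> parcs H'" for u v
    proof -
      from that obtain x y where "(x, y) \<in> parcs H" "u = f x" "v = f y" by (auto simp: H'_def)
      then show ?thesis
        using H.arcs_symmetric[of x y] by (auto simp: H'_def intro: rev_image_eqI)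
    qed
    show "(u, u) \<notin> parcs H'" for u
    proof
      assume "(u, u) \<in> parcs H'"
      then obtain x y where xy: "(x, y) \<in> parcs H" "f x = f y" by (auto simp: H'_def)
      then have "x = y" using f by (auto simp: inj_on_def dest: H.in_arcsD1 H.in_arcsD2)
      with xy show False using H.no_loops' by blast
    qed
  qed (auto simp: H'_def dest: H.in_arcsD1 H.in_arcsD2)
  have cov': "is_cover G L' H'"
    unfolding is_cover_def
  proof (intro conjI)
    show "pair_graph H'" by (rule gr)
    have disj: "disjoint_family_on L (pverts G)" using cov by (simp add: is_cover_def)
    show "disjoint_family_on L' (pverts G)"
      unfolding disjoint_family_on_def
    proof (intro ballI impI)
      fix u v assume uv: "u \<in> pverts G" "v \<in> pverts G" "u \<noteq> v"
      have "L' u \<inter> L' v = f ` (L u \<inter> L v)"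
        unfolding L'_def by (rule inj_on_image_Int[OF f, symmetric]) (use uv LH in auto)
      also have "L u \<inter> L v = {}" using disj uv by (auto simp: disjoint_family_on_def)
      finally show "L' u \<inter> L' v = {}" by simp
    qed
    have "(\<Union>u\<in>pverts G. L u) = pverts H" using cov by (simp add: is_cover_def)
    then have "pverts H' = f ` (\<Union>u\<in>pverts G. L u)" by (simp add: H'_def)
    then show "(\<Union>u\<in>pverts G. L' u) = pverts H'" by (simp add: L'_def image_UN)
    have "\<forall>u\<in>pverts G. \<forall>v\<in>pverts G.
        (\<exists>x\<in>L u. \<exists>y\<in>L v. (x, y) \<in> parcs H) \<longrightarrow> v = u \<or> (u, v) \<in> parcs G"
      using cov by (simp add: is_cover_def)
    then show "\<forall>u\<in>pverts G. \<forall>v\<in>pverts G.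
        (\<exists>x\<in>L' u. \<exists>y\<in>L' v. (x, y) \<in> parcs H') \<longrightarrow> v = u \<or> (u, v) \<in> parcs G"
      by (auto simp: L'_def arc')
    have "\<forall>u\<in>pverts G. \<forall>x\<in>L u. \<forall>y\<in>L u. x \<noteq> y \<longrightarrow> (x, y) \<in> parcs H"
      using cov by (simp add: is_cover_def)
    then show "\<forall>u\<in>pverts G. \<forall>x\<in>L' u. \<forall>y\<in>L' u. x \<noteq> y \<longrightarrow> (x, y) \<in> parcs H'"
      by (auto simp: L'_def arc') metis
    have m: "\<forall>(u, v)\<in>parcs G. \<forall>x\<in>L u. \<forall>y\<in>L v. \<forall>z\<in>L v.
        (x, y) \<in> parcs H \<longrightarrow> (x, z) \<in> parcs H \<longrightarrow> y = z"
      using cov by (simp add: is_cover_def)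
    show "\<forall>(u, v)\<in>parcs G. \<forall>x\<in>L' u. \<forall>y\<in>L' v. \<forall>z\<in>L' v.
        (x, y) \<in> parcs H' \<longrightarrow> (x, z) \<in> parcs H' \<longrightarrow> y = z"
    proof clarify
      fix u v x y z
      assume uv: "(u, v) \<in> parcs G" and "x \<in> L' u" "y \<in> L' v" "z \<in> L' v"
        and a: "(x, y) \<in> parcs H'" "(x, z) \<in> parcs H'"
      then obtain x' y' z' where xyz: "x' \<in> L u" "y' \<in> L v" "z' \<in> L v"
        and eq: "x = f x'" "y = f y'" "z = f z'" by (auto simp: L'_def)
      have "(x', y') \<in> parcs H" "(x', z') \<in> parcs H"
        using a arc'[of x' u y' v] arc'[of x' u z' v] xyz G.in_arcsD1[OF uv] G.in_arcsD2[OF uv]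
        unfolding eq by auto
      with m uv xyz have "y' = z'" by blast
      then show "y = z" by (simp add: eq)
    qed
  qed
  have cL: "card (L' u) = card (L u)" if "u \<in> pverts G" for u
    unfolding L'_def by (rule card_image) (rule inj_on_subset[OF f LH[OF that]])
  then have "\<forall>u\<in>pverts G. k \<le> card (L' u)" using k by simp
  with dp cov' obtain I' where I': "cover_coloring G L' H' I'"
    unfolding dp_colorable_def by blast
  define I where "I = {x \<in> pverts H. f x \<in> I'}"
  have "card (I \<inter> L u) = 1" if u: "u \<in> pverts G" for u
  proof -
    have "f ` (I \<inter> L u) = I' \<inter> L' u" using LH[OF u] by (auto simp: I_def L'_def)
    moreover have "card (f ` (I \<inter> L u)) = card (I \<inter> L u)"
      by (rule card_image) (rule inj_on_subset[OF f], auto simp: I_def)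
    ultimately show ?thesis using I' u by (simp add: cover_coloring_def)
  qed
  moreover have "independent_set H I"
    using I' by (auto simp: independent_set_def cover_coloring_def I_def simp flip: arc)
  ultimately have "cover_coloring G L H I" by (simp add: cover_coloring_def)
  then show ?thesis ..
qed

end

theory Submission
  imports Defs
begin

text \<open>
  Lower bound: take lists \<open>\<int>/(s+2)\<close> on the join of a complete bipartite graph with \<open>K\<^sub>s\<close>. Let the matchings
  be identities, except that bipartite edges outside a spanning tree are shifted. Colouring \<open>K\<^sub>s\<close>
  leaves the same two colours for every bipartite vertex, and the tree forces one of them on each side.
  If every nonzero shift occurs on some edge, then one of the edges is violated. With both sides of
  size about \<open>n/2\<close> there are \<open>n\<^sup>2/4 - O(n)\<close> edges outside the tree, and each can realise one shift.

  Since \<open>Z_DP\<close> is a \<open>LEAST\<close> and \<open>Z_DP_max\<close> a \<open>Max\<close>, they carry information only once \<open>Z_DP\<close> is known to be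
  bounded in terms of \<open>n\<close>. For this, colour the vertices \<open>a\<close> of \<open>K\<^sub>s\<close> one or two at a time whenever this
  costs some vertex \<open>v\<close> of the graph fewer colours than the number of vertices coloured. A vertex that
  gains \<open>n\<close> times in this way can be coloured last, so this stops after \<open>O(n\<^sup>2)\<close> steps.
  At that point, fix \<open>a\<close> and colour each of the \<open>k\<close> colour classes by the mates of one
  element of \<open>L a\<close>. Each of \<open>n\<close> selected vertices of \<open>K\<^sub>s\<close> then loses at most \<open>k\<close> colours, so \<open>K\<^sub>s\<close> can be
  coloured greedily, with the selected vertices last.
\<close>

section \<open>Greedy selection from matched lists\<close>

text \<open>The matching condition detached from \<open>G\<close>: non-edges of \<open>G\<close>
  satisfy it vacuously, so one condition covers all pairs, and it survives passing to
  sublists.\<close>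

definition matched :: "('b \<times> 'b) set \<Rightarrow> 'u set \<Rightarrow> ('u \<Rightarrow> 'b set) \<Rightarrow> bool" where
  "matched E U L \<longleftrightarrow> (\<forall>u\<in>U. \<forall>w\<in>U. u \<noteq> w \<longrightarrow>
     (\<forall>x\<in>L u. \<forall>y\<in>L w. \<forall>z\<in>L w. (x, y) \<in> E \<longrightarrow> (x, z) \<in> E \<longrightarrow> y = z))"

definition selection :: "('b \<times> 'b) set \<Rightarrow> 'u set \<Rightarrow> ('u \<Rightarrow> 'b set) \<Rightarrow> ('u \<Rightarrow> 'b) \<Rightarrow> bool" where
  "selection E U L f \<longleftrightarrow>
     (\<forall>u\<in>U. f u \<in> L u) \<and> (\<forall>u\<in>U. \<forall>w\<in>U. u \<noteq> w \<longrightarrow> (f u, f w) \<notin> E)"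

lemma matchedD:
  "matched E U L \<Longrightarrow> u \<in> U \<Longrightarrow> w \<in> U \<Longrightarrow> u \<noteq> w \<Longrightarrow> x \<in> L u \<Longrightarrow> y \<in> L w \<Longrightarrow> z \<in> L w \<Longrightarrow>
    (x, y) \<in> E \<Longrightarrow> (x, z) \<in> E \<Longrightarrow> y = z"
  unfolding matched_def by blast

lemma matched_mono:
  "matched E U L \<Longrightarrow> U' \<subseteq> U \<Longrightarrow> (\<And>u. u \<in> U' \<Longrightarrow> L' u \<subseteq> L u) \<Longrightarrow> matched E U' L'"
  unfolding matched_def by (meson subsetD)

lemma card_blocked_le:
  assumes "finite S" and "\<And>p y z. p \<in> S \<Longrightarrow> y \<in> B \<Longrightarrow> z \<in> B \<Longrightarrow> P p y \<Longrightarrow> P p z \<Longrightarrow> y = z"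
  shows "card {y \<in> B. \<exists>p\<in>S. P p y} \<le> card S"
proof -
  have sub: "{y \<in> B. \<exists>p\<in>S. P p y} \<subseteq> (\<lambda>p. THE y. y \<in> B \<and> P p y) ` S"
  proof
    fix y assume "y \<in> {y \<in> B. \<exists>p\<in>S. P p y}"
    then obtain p where p: "y \<in> B" "p \<in> S" "P p y" by blast
    then have "(THE y. y \<in> B \<and> P p y) = y" using assms(2) by (intro the_equality) blast+
    with p show "y \<in> (\<lambda>p. THE y. y \<in> B \<and> P p y) ` S" by (intro image_eqI[of _ _ p]) simp_all
  qed
  show "card {y \<in> B. \<exists>p\<in>S. P p y} \<le> card S"
    using card_mono[OF _ sub] card_image_le[OF assms(1)] assms(1) by (meson finite_imageI le_trans)
qed

text \<open>Each \<open>p\<close> blocks at most one element of \<open>B\<close>; the greedy counts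
  below rest on this. For infinite \<open>B\<close> the left side is 0.\<close>

lemma card_unblocked_ge:
  assumes "finite S" and "\<And>p y z. p \<in> S \<Longrightarrow> y \<in> B \<Longrightarrow> z \<in> B \<Longrightarrow> P p y \<Longrightarrow> P p z \<Longrightarrow> y = z"
  shows "card B \<le> card {y \<in> B. \<forall>p\<in>S. \<not> P p y} + card S"
proof (cases "finite B")
  case True
  have "card B = card ({y \<in> B. \<forall>p\<in>S. \<not> P p y} \<union> {y \<in> B. \<exists>p\<in>S. P p y})"
    by (rule arg_cong[of _ _ card]) auto
  also have "\<dots> \<le> card {y \<in> B. \<forall>p\<in>S. \<not> P p y} + card {y \<in> B. \<exists>p\<in>S. P p y}" by (rule card_Un_le)
  finally show ?thesis using card_blocked_le[of S B P] assms by (meson add_left_mono le_trans)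
qed simp

lemma selection_extend:
  assumes E: "sym E" and m: "matched E (insert v U) L" and U: "finite U" "v \<notin> U"
    and c: "card U < card (L v)" and f: "selection E U L f"
  shows "\<exists>y. selection E (insert v U) L (f(v := y))"
proof -
  have "card (L v) \<le> card {y \<in> L v. \<forall>u\<in>U. (f u, y) \<notin> E} + card U"
  proof (rule card_unblocked_ge[OF U(1)])
    fix p y z assume p: "p \<in> U" "y \<in> L v" "z \<in> L v" "(f p, y) \<in> E" "(f p, z) \<in> E"
    have "f p \<in> L p" using f p(1) by (auto simp: selection_def)
    then show "y = z" using matchedD[OF m, of p v "f p" y z] p U(2) by auto
  qed
  with c have "card {y \<in> L v. \<forall>u\<in>U. (f u, y) \<notin> E} \<noteq> 0" by linarith
  then have "{y \<in> L v. \<forall>u\<in>U. (f u, y) \<notin> E} \<noteq> {}" by (metis card.empty)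
  then obtain y where y: "y \<in> L v" "\<forall>u\<in>U. (f u, y) \<notin> E" by blast
  then have "\<forall>u\<in>U. (y, f u) \<notin> E" using E by (meson symE)
  with y f U(2) have "selection E (insert v U) L (f(v := y))" by (auto simp: selection_def)
  then show ?thesis ..
qed

text \<open>Greedy colouring of \<open>W\<close>: whenever some \<open>w\<close> comes up, fewer
  than \<open>card U + card W\<close> vertices are coloured.\<close>

lemma selection_extend_set:
  assumes E: "sym E" and W: "finite W" and U: "finite U" and m: "matched E (U \<union> W) L"
    and disj: "U \<inter> W = {}" and c: "\<And>w. w \<in> W \<Longrightarrow> card U + card W \<le> card (L w)"
    and f: "selection E U L f"
  shows "\<exists>g. selection E (U \<union> W) L g"
  using W m disj c
proof (induction W)
  case empty
  then show ?case using f by auto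
next
  case (insert w W)
  have "\<exists>g. selection E (U \<union> W) L g"
  proof (rule insert.IH)
    show "matched E (U \<union> W) L" using insert.prems(1) by (rule matched_mono) auto
    show "card U + card W \<le> card (L w')" if "w' \<in> W" for w'
      using insert.prems(3)[of w'] insert.hyps that by simp
  qed (use insert.prems in auto)
  then obtain g where g: "selection E (U \<union> W) L g" ..
  have "\<exists>y. selection E (insert w (U \<union> W)) L (g(w := y))"
  proof (rule selection_extend[OF E _ _ _ _ g])
    show "matched E (insert w (U \<union> W)) L" using insert.prems(1) by simp
    show "card (U \<union> W) < card (L w)"
      using insert.prems(3)[of w] insert.hyps card_Un_le[of U W] by simp
  qed (use insert U in auto)
  then show ?case by auto
qed

text \<open>Colouring \<open>S\<close> first amounts to shrinking the other lists to the elements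
  compatible with it.\<close>

lemma selection_Un:
  assumes E: "sym E" and g: "selection E S L g" and ST: "S \<inter> T = {}"
    and f: "selection E T (\<lambda>u. {y \<in> L u. \<forall>b\<in>S. (g b, y) \<notin> E}) f"
  shows "selection E (S \<union> T) L (\<lambda>u. if u \<in> S then g u else f u)"
  using assms unfolding selection_def by (auto dest: symD)

lemma card_restricted_ge:
  assumes m: "matched E U L" and S: "finite S" "S \<subseteq> U" and g: "\<And>b. b \<in> S \<Longrightarrow> g b \<in> L b"
    and u: "u \<in> U" "u \<notin> S"
  shows "card (L u) \<le> card {y \<in> L u. \<forall>b\<in>S. (g b, y) \<notin> E} + card S"
proof (rule card_unblocked_ge[OF S(1)])
  fix b y z assume "b \<in> S" "y \<in> L u" "z \<in> L u" "(g b, y) \<in> E" "(g b, z) \<in> E"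
  then show "y = z" using matchedD[OF m, of b u "g b" y z] S u g by blast
qed

section \<open>Colouring when the vertices of K_s yield no savings\<close>

text \<open>The classes get their labels one after another. For \<open>u\<close> in an earlier class
  and \<open>v\<close> in the new one, at most one label is bad: follow the matchings from
  \<open>\<xi> (C u)\<close> to \<open>L u\<close>, to \<open>L v\<close> and back to
  \<open>L a\<close>. So fewer than \<open>card (L a)\<close> labels are excluded.\<close>

lemma exists_class_labels:
  fixes L :: "'u \<Rightarrow> 'b set" and C :: "'u \<Rightarrow> nat"
  assumes E: "sym E" and V: "finite V" and a: "a \<notin> V" and m: "matched E (insert a V) L"
    and c: "card V * card V < card (L a)"
  shows "\<exists>\<xi>::nat \<Rightarrow> 'b. (\<forall>j<i. \<xi> j \<in> L a) \<and>
    (\<forall>u\<in>V. \<forall>v\<in>V. \<forall>y\<in>L u. \<forall>z\<in>L v. C u < i \<longrightarrow> C v < i \<longrightarrow> C u \<noteq> C v \<longrightarrow>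
      (\<xi> (C u), y) \<in> E \<longrightarrow> (\<xi> (C v), z) \<in> E \<longrightarrow> (y, z) \<notin> E)"
proof (induction i)
  case (Suc i)
  then obtain \<xi> :: "nat \<Rightarrow> 'b" where x1: "\<forall>j<i. \<xi> j \<in> L a" and
    x2: "\<And>u v y z. u \<in> V \<Longrightarrow> v \<in> V \<Longrightarrow> y \<in> L u \<Longrightarrow> z \<in> L v \<Longrightarrow> C u < i \<Longrightarrow> C v < i \<Longrightarrow> C u \<noteq> C v \<Longrightarrow>
      (\<xi> (C u), y) \<in> E \<Longrightarrow> (\<xi> (C v), z) \<in> E \<Longrightarrow> (y, z) \<notin> E" by blast
  \<comment> \<open>\<open>P (u, v) x\<close>: with label \<open>x\<close> for its class,
    \<open>v\<close> would conflict with the already labelled \<open>u\<close>. Letting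
    \<open>v\<close> range over all of \<open>V\<close> gives the bound
    \<open>card V * card V\<close>.\<close>
  define P where "P p x \<longleftrightarrow> C (fst p) < i \<and>
    (\<exists>y\<in>L (fst p). \<exists>z\<in>L (snd p). fst p \<noteq> snd p \<and> (\<xi> (C (fst p)), y) \<in> E \<and> (x, z) \<in> E \<and> (y, z) \<in> E)"
    for p x
  have "card (L a) \<le> card {x \<in> L a. \<forall>p\<in>V \<times> V. \<not> P p x} + card (V \<times> V)"
  proof (rule card_unblocked_ge)
    fix p x x' assume p: "p \<in> V \<times> V" "x \<in> L a" "x' \<in> L a" "P p x" "P p x'"
    obtain u v where uv: "p = (u, v)" "u \<in> V" "v \<in> V" using p(1) by auto
    from p(4,5) obtain y z y' z' where yz: "C u < i" "u \<noteq> v" "y \<in> L u" "z \<in> L v" "y' \<in> L u" "z' \<in> L v"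
      "(\<xi> (C u), y) \<in> E" "(x, z) \<in> E" "(y, z) \<in> E" "(\<xi> (C u), y') \<in> E" "(x', z') \<in> E" "(y', z') \<in> E"
      unfolding P_def uv by auto
    have "y = y'" using matchedD[OF m, of a u "\<xi> (C u)" y y'] yz uv a x1 by auto
    then have "z = z'" using matchedD[OF m, of u v y z z'] yz uv by auto
    moreover have "(z, x) \<in> E" "(z', x') \<in> E" using yz E by (auto dest: symD)
    ultimately show "x = x'" using matchedD[OF m, of v a z x x'] yz uv a p by auto
  qed (use V in simp)
  with c have "card {x \<in> L a. \<forall>p\<in>V \<times> V. \<not> P p x} \<noteq> 0"
    unfolding card_cartesian_product by linarith
  then have "{x \<in> L a. \<forall>p\<in>V \<times> V. \<not> P p x} \<noteq> {}" by (metis card.empty)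
  then obtain x where x: "x \<in> L a" "\<And>u v. u \<in> V \<Longrightarrow> v \<in> V \<Longrightarrow> \<not> P (u, v) x" by blast
  have new: "(y, z) \<notin> E" if "u \<in> V" "v \<in> V" "y \<in> L u" "z \<in> L v" "C u < i" "C v = i"
    "(\<xi> (C u), y) \<in> E" "(x, z) \<in> E" for u v y z
    using x(2)[OF that(1,2)] that unfolding P_def by auto
  show ?case
  proof (intro exI[of _ "\<xi>(i := x)"] conjI ballI allI impI)
    fix u v y z
    assume "u \<in> V" "v \<in> V" "y \<in> L u" "z \<in> L v" "C u < Suc i" "C v < Suc i" "C u \<noteq> C v"
      "((\<xi>(i := x)) (C u), y) \<in> E" "((\<xi>(i := x)) (C v), z) \<in> E"
    then consider "C u < i" "C v < i" "C u \<noteq> C v" "(\<xi> (C u), y) \<in> E" "(\<xi> (C v), z) \<in> E"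
      | "C u < i" "C v = i" "(\<xi> (C u), y) \<in> E" "(x, z) \<in> E"
      | "C v < i" "C u = i" "(\<xi> (C v), z) \<in> E" "(x, y) \<in> E"
      by (auto simp: less_Suc_eq)
    then show "(y, z) \<notin> E"
    proof cases
      case 1
      with x2 \<open>u \<in> V\<close> \<open>v \<in> V\<close> \<open>y \<in> L u\<close> \<open>z \<in> L v\<close> show ?thesis by blast
    next
      case 2
      with new \<open>u \<in> V\<close> \<open>v \<in> V\<close> \<open>y \<in> L u\<close> \<open>z \<in> L v\<close> show ?thesis by blast
    next
      case 3
      with new \<open>u \<in> V\<close> \<open>v \<in> V\<close> \<open>y \<in> L u\<close> \<open>z \<in> L v\<close> have "(z, y) \<notin> E" by blast
      with E show ?thesis by (meson symD)
    qed
  qed (use x x1 in \<open>auto simp: less_Suc_eq\<close>)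
qed simp

text \<open>
The last two hypotheses say that colouring \<open>a\<close>, or \<open>a\<close> and some \<open>b\<close> in \<open>A0\<close>, saves no colour at any \<open>v\<close> in \<open>V\<close>.
\<close>

lemma selection_of_no_gain:
  fixes L :: "'u \<Rightarrow> 'b set"
  assumes E: "sym E" and V: "finite V" and A: "finite A" and VA: "V \<inter> A = {}"
    and m: "matched E (V \<union> A) L"
    and C: "\<And>v. v \<in> V \<Longrightarrow> C v < (k::nat)"
    and same: "\<And>u v x y. u \<in> V \<Longrightarrow> v \<in> V \<Longrightarrow> u \<noteq> v \<Longrightarrow> C u = C v \<Longrightarrow> x \<in> L u \<Longrightarrow> y \<in> L v \<Longrightarrow> (x, y) \<notin> E"
    and LA: "\<And>a. a \<in> A \<Longrightarrow> card A + k \<le> card (L a)"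
    and a: "a \<in> A" "card V * card V < card (L a)"
    and A0: "A0 \<subseteq> A" "a \<notin> A0" "card A0 = card V"
    and tot: "\<And>x v. x \<in> L a \<Longrightarrow> v \<in> V \<Longrightarrow> \<exists>y\<in>L v. (x, y) \<in> E"
    and ng: "\<And>x v b y x'. x \<in> L a \<Longrightarrow> v \<in> V \<Longrightarrow> b \<in> A0 \<Longrightarrow> y \<in> L v \<Longrightarrow> x' \<in> L b \<Longrightarrow>
       (x, y) \<in> E \<Longrightarrow> (y, x') \<in> E \<Longrightarrow> (x, x') \<in> E"
  shows "\<exists>f. selection E (V \<union> A) L f"
proof -
  have m': "matched E (insert a V) L" using m by (rule matched_mono) (use a in auto)
  have "a \<notin> V" using a VA by auto
  from exists_class_labels[OF E V this m' a(2), of k C] obtain \<xi> :: "nat \<Rightarrow> 'b" where x1: "\<forall>j<k. \<xi> j \<in> L a" and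
    x2: "\<And>u v y z. u \<in> V \<Longrightarrow> v \<in> V \<Longrightarrow> y \<in> L u \<Longrightarrow> z \<in> L v \<Longrightarrow> C u < k \<Longrightarrow> C v < k \<Longrightarrow> C u \<noteq> C v \<Longrightarrow>
      (\<xi> (C u), y) \<in> E \<Longrightarrow> (\<xi> (C v), z) \<in> E \<Longrightarrow> (y, z) \<notin> E" by blast
  have "\<forall>v\<in>V. \<exists>y. y \<in> L v \<and> (\<xi> (C v), y) \<in> E" using tot x1 C by blast
  then obtain g where g: "\<And>v. v \<in> V \<Longrightarrow> g v \<in> L v" "\<And>v. v \<in> V \<Longrightarrow> (\<xi> (C v), g v) \<in> E" by metis
  \<comment> \<open>Inside a class \<open>same\<close> excludes edges; between classes the choice of
    the labels does.\<close>
  have selg: "selection E V L g"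
    unfolding selection_def using g x2 same C by metis
  define L' where "L' u = {y \<in> L u. \<forall>v\<in>V. (g v, y) \<notin> E}" for u
  have mA: "matched E A L'" using m by (rule matched_mono) (auto simp: L'_def)
  have fin: "finite A0" using A A0(1) finite_subset by blast
  have cA: "card (A - A0) + card V = card A"
    using A A0 card_Diff_subset[OF fin A0(1)] card_mono[OF A A0(1)] by simp
  \<comment> \<open>A vertex outside \<open>A0\<close> has lost at most \<open>card V\<close>
    colours, and only \<open>card A - card V\<close> vertices are coloured here, so greedy colouring
    succeeds.\<close>
  have "\<exists>h. selection E ({} \<union> (A - A0)) L' h"
  proof (rule selection_extend_set[OF E])
    show "matched E ({} \<union> (A - A0)) L'" using mA by (rule matched_mono) auto
    show "card {} + card (A - A0) \<le> card (L' w)" if "w \<in> A - A0" for w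
    proof -
      have "card (L w) \<le> card (L' w) + card V"
        unfolding L'_def by (rule card_restricted_ge[OF m V]) (use that VA g in auto)
      with LA[of w] that cA show ?thesis by simp
    qed
    show "selection E {} L' g" by (simp add: selection_def)
  qed (use A in auto)
  then obtain h where h: "selection E (A - A0) L' h" by auto
  have "\<exists>h. selection E ((A - A0) \<union> A0) L' h"
  proof (rule selection_extend_set[OF E _ _ _ _ _ h])
    show "matched E (A - A0 \<union> A0) L'" using mA by (rule matched_mono) (use A0 in auto)
    show "card (A - A0) + card A0 \<le> card (L' b)" if b: "b \<in> A0" for b
    proof -
      \<comment> \<open>By \<open>ng\<close>, a colour of \<open>b\<close> blocked by some
        \<open>g v\<close> is also adjacent to the label of the class of \<open>v\<close>. So at
        most \<open>k\<close> colours are blocked, and the surplus \<open>k\<close> in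
        \<open>LA\<close> pays for them.\<close>
      have "card (L b) \<le> card {y \<in> L b. \<forall>j\<in>{..<k}. (\<xi> j, y) \<notin> E} + card {..<k}"
      proof (rule card_unblocked_ge)
        fix p y z assume "p \<in> {..<k}" "y \<in> L b" "z \<in> L b" "(\<xi> p, y) \<in> E" "(\<xi> p, z) \<in> E"
        then show "y = z" using matchedD[OF m, of a b "\<xi> p" y z] a A0 b x1 by auto
      qed simp
      also have "card {y \<in> L b. \<forall>j\<in>{..<k}. (\<xi> j, y) \<notin> E} \<le> card (L' b)"
      proof (rule card_mono)
        have "card A > 0" using a(1) A by (auto simp: card_gt_0_iff)
        then have "finite (L b)" using LA[of b] b A0 by (intro card_ge_0_finite) auto
        then show "finite (L' b)" by (simp add: L'_def)
        show "{y \<in> L b. \<forall>j\<in>{..<k}. (\<xi> j, y) \<notin> E} \<subseteq> L' b"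
        proof clarify
          fix y assume y: "y \<in> L b" "\<forall>j\<in>{..<k}. (\<xi> j, y) \<notin> E"
          have "(g v, y) \<notin> E" if v: "v \<in> V" for v
            using ng[of "\<xi> (C v)" v b "g v" y] g[OF v] C[OF v] x1 v b y by auto
          with y(1) show "y \<in> L' b" by (simp add: L'_def)
        qed
      qed
      finally show ?thesis using LA[of b] b A0 cA by auto
    qed
  qed (use A fin in auto)
  moreover have "A - A0 \<union> A0 = A" using A0 by auto
  ultimately obtain h' where "selection E A L' h'" by auto
  from selection_Un[OF E selg VA this[unfolded L'_def[abs_def]]]
  show ?thesis by (intro exI[of _ "\<lambda>u. if u \<in> V then g u else h' u"])
qed

text \<open>
Here \<open>e v\<close> counts the savings already made at \<open>v\<close>.
\<close>

lemma selection_of_long_lists: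
  fixes L :: "'u \<Rightarrow> 'b set"
  assumes E: "sym E" and "finite V" and "finite A" and "V \<inter> A = {}"
    and "matched E (V \<union> A) L"
    and "\<And>v. v \<in> V \<Longrightarrow> C v < (k::nat)"
    and "\<And>u v x y. u \<in> V \<Longrightarrow> v \<in> V \<Longrightarrow> u \<noteq> v \<Longrightarrow> C u = C v \<Longrightarrow> x \<in> L u \<Longrightarrow> y \<in> L v \<Longrightarrow> (x, y) \<notin> E"
    and "\<And>a. a \<in> A \<Longrightarrow> card A + k \<le> card (L a)"
    and "\<And>v. v \<in> V \<Longrightarrow> card A + k + e v \<le> card (L v)"
    and "card V \<le> n"
    and "2 * (card V + (\<Sum>v\<in>V. n - e v)) + n * n + n + 1 \<le> card A"
  shows "\<exists>f. selection E (V \<union> A) L f"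
  using assms(2-)
proof (induction "card V + (\<Sum>v\<in>V. n - e v)" arbitrary: V A L e rule: less_induct)
  \<comment> \<open>The measure bounds the remaining steps: \<open>n - e v\<close> savings are open
    at \<open>v\<close>, and \<open>v\<close> itself may be set aside. A step uses at most two
    vertices of \<open>A\<close>, hence the factor 2; the rest of the bound on \<open>card A\<close>
    is reserved for the final stage.\<close>
  case less
  note V = less.prems(1) and A = less.prems(2) and VA = less.prems(3) and m = less.prems(4)
    and C = less.prems(5) and same = less.prems(6) and LA = less.prems(7) and LV = less.prems(8)
    and n = less.prems(9) and big = less.prems(10)
  \<comment> \<open>If colouring \<open>S\<close> costs \<open>v\<close> fewer than
    \<open>card S\<close> elements, \<open>card A\<close> falls by more than the size of
    \<open>L v\<close> does, so \<open>LV\<close> survives with \<open>e v\<close> raised by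
    one.\<close>
  have gain: "\<exists>f. selection E (V \<union> A) L f"
    if S: "S \<subseteq> A" "card S \<le> 2" and g: "selection E S L g"
      and v: "v \<in> V" "e v < n" and cv: "card (L v) < card {y \<in> L v. \<forall>b\<in>S. (g b, y) \<notin> E} + card S"
    for S g v
  proof -
    define L' where "L' u = {y \<in> L u. \<forall>b\<in>S. (g b, y) \<notin> E}" for u
    define e' where "e' = e(v := Suc (e v))"
    have finS: "finite S" using S A finite_subset by blast
    have cAS: "card (A - S) + card S = card A"
      using A S(1) finS card_Diff_subset[OF finS S(1)] card_mono[OF A S(1)] by simp
    have sum: "(\<Sum>v\<in>V. n - e v) = Suc (\<Sum>v\<in>V. n - e' v)"
    proof -
      have "(\<Sum>u\<in>V - {v}. n - e' u) = (\<Sum>u\<in>V - {v}. n - e u)"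
        by (rule sum.cong) (auto simp: e'_def)
      then show ?thesis
        using v V by (simp add: sum.remove[of V v] e'_def)
    qed
    have loss: "card (L u) \<le> card (L' u) + card S" if "u \<in> V \<union> A" "u \<notin> S" for u
      unfolding L'_def by (rule card_restricted_ge[OF m finS]) (use that S g in \<open>auto simp: selection_def\<close>)
    have "\<exists>f. selection E (V \<union> (A - S)) L' f"
    proof (rule less.hyps[of V e' "A - S" L'])
      show "matched E (V \<union> (A - S)) L'" using m by (rule matched_mono) (auto simp: L'_def)
      show "(x, y) \<notin> E" if "u \<in> V" "w \<in> V" "u \<noteq> w" "C u = C w" "x \<in> L' u" "y \<in> L' w" for u w x y
        using same that unfolding L'_def by blast
      show "card (A - S) + k \<le> card (L' a)" if "a \<in> A - S" for a
        using LA[of a] loss[of a] that cAS by auto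
      show "card (A - S) + k + e' u \<le> card (L' u)" if "u \<in> V" for u
      proof (cases "u = v")
        case True
        then show ?thesis using LV[of u] cv that cAS by (auto simp: e'_def L'_def)
      next
        case False
        have uS: "u \<notin> S" using VA S that by auto
        show ?thesis using False LV[of u] loss[of u] that cAS by (auto simp: e'_def uS)
      qed
      show "2 * (card V + (\<Sum>v\<in>V. n - e' v)) + n * n + n + 1 \<le> card (A - S)"
        using big S(2) sum cAS by simp
    qed (use V A VA C n sum in auto)
    then obtain f where f: "selection E (V \<union> (A - S)) L' f" ..
    have "selection E (S \<union> (V \<union> (A - S))) L (\<lambda>u. if u \<in> S then g u else f u)"
      by (rule selection_Un[OF E g]) (use f VA S in \<open>auto simp: L'_def[abs_def]\<close>)
    moreover have "S \<union> (V \<union> (A - S)) = V \<union> A" using S by auto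
    ultimately show ?thesis by auto
  qed
  show ?case
  proof (cases "\<exists>v\<in>V. n \<le> e v")
    case True
    then obtain v where v: "v \<in> V" "n \<le> e v" by blast
    have cV: "Suc (card (V - {v})) = card V" using card.remove[OF V v(1)] by simp
    have sm: "(\<Sum>v\<in>V. n - e v) = (\<Sum>v\<in>V - {v}. n - e v)" using v V by (simp add: sum.remove[of V v])
    \<comment> \<open>Set \<open>v\<close> aside and colour it last: its surplus
      \<open>e v \<ge> n \<ge> card V\<close> exceeds the number of other vertices of
      \<open>V\<close>.\<close>
    have "\<exists>f. selection E (V - {v} \<union> A) L f"
    proof (rule less.hyps[of "V - {v}" e A L])
      show "matched E (V - {v} \<union> A) L" using m by (rule matched_mono) auto
      show "(x, y) \<notin> E"
        if "u \<in> V - {v}" "w \<in> V - {v}" "u \<noteq> w" "C u = C w" "x \<in> L u" "y \<in> L w" for u w x y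
        using same that by blast
    qed (use V A VA C n sm cV LA LV big in auto)
    then obtain f where f: "selection E (V - {v} \<union> A) L f" ..
    have ins: "insert v (V - {v} \<union> A) = V \<union> A" using v by auto
    have "\<exists>y. selection E (insert v (V - {v} \<union> A)) L (f(v := y))"
    proof (rule selection_extend[OF E _ _ _ _ f])
      show "card (V - {v} \<union> A) < card (L v)"
        using card_Un_le[of "V - {v}" A] cV n v LV[OF v(1)] by linarith
    qed (use m ins V A VA v in auto)
    then show ?thesis unfolding ins by blast
  next
    case False
    then have en: "\<And>v. v \<in> V \<Longrightarrow> e v < n" by auto
    have "card V + 1 \<le> card A" using big n by simp
    then have "A \<noteq> {}" by auto
    then obtain a where a: "a \<in> A" by blast
    have "card V \<le> card (A - {a})" using \<open>card V + 1 \<le> card A\<close> a A by simp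
    then obtain A0 where A0: "A0 \<subseteq> A - {a}" "card A0 = card V" by (metis obtain_subset_with_card_n)
    have "card V * card V < card (L a)"
      using LA[OF a] big mult_le_mono[OF n n] by linarith
    show ?thesis
    proof (cases "\<exists>x\<in>L a. \<exists>v\<in>V. \<forall>y\<in>L v. (x, y) \<notin> E")
      case True
      then obtain x v where xv: "x \<in> L a" "v \<in> V" "\<forall>y\<in>L v. (x, y) \<notin> E" by blast
      \<comment> \<open>An \<open>x\<close> without a mate in \<open>L v\<close> colours
        \<open>a\<close> at no cost to \<open>v\<close>.\<close>
      then have "{y \<in> L v. \<forall>b\<in>{a}. (x, y) \<notin> E} = L v" by auto
      then show ?thesis
        using gain[of "{a}" "\<lambda>_. x" v] xv a en by (auto simp: selection_def)
    next
      case tot: False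
      show ?thesis
      proof (cases "\<exists>x\<in>L a. \<exists>v\<in>V. \<exists>b\<in>A0. \<exists>y\<in>L v. \<exists>x'\<in>L b. (x, y) \<in> E \<and> (y, x') \<in> E \<and> (x, x') \<notin> E")
        case True
        then obtain x v b y x' where h: "x \<in> L a" "v \<in> V" "b \<in> A0" "y \<in> L v" "x' \<in> L b"
          "(x, y) \<in> E" "(y, x') \<in> E" "(x, x') \<notin> E" by blast
        have ab: "a \<noteq> b" "b \<in> A" using h A0 by auto
        define g where "g = (\<lambda>u. if u = a then x else x')"
        \<comment> \<open>\<open>x\<close> and \<open>x'\<close> both block only \<open>y\<close> in
          \<open>L v\<close>, so colouring \<open>a\<close> and \<open>b\<close> costs
          \<open>v\<close> one element instead of two. The index set \<open>{()}\<close> expresses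
          this single block.\<close>
        have "card (L v) \<le> card {z \<in> L v. \<forall>p\<in>{()}. \<not> ((x, z) \<in> E \<or> (x', z) \<in> E)} + card {()}"
        proof (rule card_unblocked_ge)
          have "(x, z) \<in> E \<or> (x', z) \<in> E \<Longrightarrow> z = y" if "z \<in> L v" for z
            using matchedD[OF m, of a v x y z] matchedD[OF m, of b v x' y z] h a ab VA that symD[OF E, of y x']
            by blast
          then show "z = z'" if "z \<in> L v" "z' \<in> L v" "(x, z) \<in> E \<or> (x', z) \<in> E" "(x, z') \<in> E \<or> (x', z') \<in> E" for z z'
            using that by blast
        qed simp
        moreover have "{z \<in> L v. \<forall>p\<in>{()}. \<not> ((x, z) \<in> E \<or> (x', z) \<in> E)} = {z \<in> L v. \<forall>u\<in>{a, b}. (g u, z) \<notin> E}"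
          using ab by (auto simp: g_def)
        ultimately have "card (L v) < card {z \<in> L v. \<forall>u\<in>{a, b}. (g u, z) \<notin> E} + card {a, b}"
          using ab by simp
        moreover have "selection E {a, b} L g"
          using ab h symD[OF E, of x' x] by (auto simp: selection_def g_def)
        ultimately show ?thesis
          using gain[of "{a, b}" g v] h a ab en by simp
      next
        case False
        show ?thesis
        proof (rule selection_of_no_gain[OF E V A VA m C same LA a])
          show "card V * card V < card (L a)" by fact
          show "A0 \<subseteq> A" "a \<notin> A0" "card A0 = card V" using A0 by auto
          show "\<exists>y\<in>L v. (x, y) \<in> E" if "x \<in> L a" "v \<in> V" for x v using tot that by blast
          show "(x, x') \<in> E" if "x \<in> L a" "v \<in> V" "b \<in> A0" "y \<in> L v" "x' \<in> L b" "(x, y) \<in> E" "(y, x') \<in> E"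
            for x v b y x' using False that by blast
        qed
      qed
    qed
  qed
qed

section \<open>Covers as selections; DP-colorability and proper colorings\<close>

lemma is_coverD:
  assumes "is_cover G L H"
  shows "sym (parcs H)" "matched (parcs H) (pverts G) L"
    and "\<And>u. u \<in> pverts G \<Longrightarrow> L u \<subseteq> pverts H"
    and "\<And>u v x y. u \<in> pverts G \<Longrightarrow> v \<in> pverts G \<Longrightarrow> u \<noteq> v \<Longrightarrow> (u, v) \<notin> parcs G \<Longrightarrow> x \<in> L u \<Longrightarrow>
      y \<in> L v \<Longrightarrow> (x, y) \<notin> parcs H"
proof -
  interpret H: pair_graph H using assms by (simp add: is_cover_def)
  show "sym (parcs H)" by (rule symI) (rule H.arcs_symmetric)
  show na: "(x, y) \<notin> parcs H" if "u \<in> pverts G" "v \<in> pverts G" "u \<noteq> v" "(u, v) \<notin> parcs G" "x \<in> L u" "y \<in> L v"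
    for u v x y
    using assms that unfolding is_cover_def by blast
  show "L u \<subseteq> pverts H" if "u \<in> pverts G" for u
    using assms that unfolding is_cover_def by blast
  have mt: "\<forall>(u, v)\<in>parcs G. \<forall>x\<in>L u. \<forall>y\<in>L v. \<forall>z\<in>L v.
        (x, y) \<in> parcs H \<longrightarrow> (x, z) \<in> parcs H \<longrightarrow> y = z"
    using assms by (simp add: is_cover_def)
  show "matched (parcs H) (pverts G) L"
    unfolding matched_def
  proof (intro ballI impI)
    fix u w x y z
    assume "u \<in> pverts G" "w \<in> pverts G" "u \<noteq> w" "x \<in> L u" "y \<in> L w" "z \<in> L w"
      "(x, y) \<in> parcs H" "(x, z) \<in> parcs H"
    then show "y = z" using na[of u w x y] mt by (cases "(u, w) \<in> parcs G") blast+
  qed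
qed

lemma cover_coloring_if_selection:
  assumes cov: "is_cover G L H" and f: "selection (parcs H) (pverts G) L f"
  shows "cover_coloring G L H (f ` pverts G)"
proof -
  interpret H: pair_graph H using cov by (simp add: is_cover_def)
  have disj: "disjoint_family_on L (pverts G)" using cov by (simp add: is_cover_def)
  have mem: "f u \<in> L u" if "u \<in> pverts G" for u using f that by (simp add: selection_def)
  have "f ` pverts G \<inter> L u = {f u}" if u: "u \<in> pverts G" for u
  proof -
    have "v = u" if "v \<in> pverts G" "f v \<in> L u" for v
      using disj mem[OF that(1)] that u unfolding disjoint_family_on_def by blast
    then show ?thesis using mem u by auto
  qed
  moreover have "(f u, f v) \<notin> parcs H" if "u \<in> pverts G" "v \<in> pverts G" for u v
    using f that H.no_loops' by (cases "u = v") (auto simp: selection_def)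
  ultimately show ?thesis
    using subsetD[OF is_coverD(3)[OF cov] mem]
    by (auto simp: cover_coloring_def independent_set_def)
qed

lemma dp_colorable_mono: "dp_colorable G k \<Longrightarrow> k \<le> l \<Longrightarrow> dp_colorable G l"
  unfolding dp_colorable_def by (meson le_trans)

text \<open>Greedy colouring works with lists this long. Hence the \<open>LEAST\<close> in
  \<open>dp_chromatic_number\<close> is attained.\<close>

lemma dp_colorable_card:
  assumes "pair_graph G"
  shows "dp_colorable G (card (pverts G))"
  unfolding dp_colorable_def
proof (intro allI impI, elim conjE)
  interpret pair_graph G by fact
  fix L :: "'a \<Rightarrow> nat set" and H
  assume cov: "is_cover G L H" and k: "\<forall>u\<in>pverts G. card (pverts G) \<le> card (L u)"
  have "\<exists>g. selection (parcs H) ({} \<union> pverts G) L g"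
    by (rule selection_extend_set[OF is_coverD(1)[OF cov]])
      (use is_coverD(2)[OF cov] k in \<open>auto simp: selection_def\<close>)
  then show "\<exists>I. cover_coloring G L H I" using cover_coloring_if_selection[OF cov] by auto
qed

lemma dp_colorable_dp_chromatic_number:
  "pair_graph G \<Longrightarrow> dp_colorable G (dp_chromatic_number G)"
  unfolding dp_chromatic_number_def by (rule LeastI) (rule dp_colorable_card)

text \<open>A conflict relation \<open>R\<close> becomes a cover on pairs of vertex and colour:
  symmetry makes it a graph, and functionality, read in both directions of an edge, gives matchings.
  Identity matchings and cyclic shifts are both of this form.\<close>

lemma dp_colorable_avoid_conflicts:
  assumes dp: "dp_colorable G k" and G: "pair_graph G"
    and sym: "\<And>u v i j. (u, v) \<in> parcs G \<Longrightarrow> i < k \<Longrightarrow> j < k \<Longrightarrow> R u i v j \<Longrightarrow> R v j u i"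
    and functional: "\<And>u v i j l. (u, v) \<in> parcs G \<Longrightarrow> i < k \<Longrightarrow> j < k \<Longrightarrow> l < k \<Longrightarrow>
      R u i v j \<Longrightarrow> R u i v l \<Longrightarrow> j = l"
  shows "\<exists>f. (\<forall>u\<in>pverts G. f u < k) \<and> (\<forall>(u, v)\<in>parcs G. \<not> R u (f u) v (f v))"
proof -
  interpret G: pair_graph G by fact
  define L :: "'a \<Rightarrow> ('a \<times> nat) set" where "L u = {u} \<times> {..<k}" for u
  define H where "H = \<lparr>pverts = pverts G \<times> {..<k},
    parcs = {((u, i), (v, j)) | u i v j. u \<in> pverts G \<and> v \<in> pverts G \<and> i < k \<and> j < k \<and>
      (u = v \<and> i \<noteq> j \<or> (u, v) \<in> parcs G \<and> R u i v j)}\<rparr>"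
  have arcs: "((u, i), (v, j)) \<in> parcs H \<longleftrightarrow> u \<in> pverts G \<and> v \<in> pverts G \<and> i < k \<and> j < k \<and>
      (u = v \<and> i \<noteq> j \<or> (u, v) \<in> parcs G \<and> R u i v j)" for u i v j
    by (auto simp: H_def)
  have "pair_graph H"
  proof (rule pair_graphI)
    show "finite (pverts H)" by (simp add: H_def)
    show "parcs H \<subseteq> pverts H \<times> pverts H" by (auto simp: H_def)
    show "(y, x) \<in> parcs H" if xy: "(x, y) \<in> parcs H" for x y
    proof -
      obtain u i v j where [simp]: "x = (u, i)" "y = (v, j)" by (cases x; cases y)
      from xy show ?thesis
        using sym[of u v i j] G.arcs_symmetric[of u v] unfolding arcs \<open>x = _\<close> \<open>y = _\<close> by blast
    qed
    show "(x, x) \<notin> parcs H" for x using G.no_loops' by (cases x) (auto simp: arcs)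
  qed
  then have cov: "is_cover G L H"
    unfolding is_cover_def
  proof (intro conjI)
    show "disjoint_family_on L (pverts G)" by (auto simp: disjoint_family_on_def L_def)
    show "(\<Union>u\<in>pverts G. L u) = pverts H" by (auto simp: L_def H_def)
    show "\<forall>u\<in>pverts G. \<forall>v\<in>pverts G. (\<exists>x\<in>L u. \<exists>y\<in>L v. (x, y) \<in> parcs H) \<longrightarrow> v = u \<or> (u, v) \<in> parcs G"
      by (auto simp: L_def arcs)
    show "\<forall>u\<in>pverts G. \<forall>x\<in>L u. \<forall>y\<in>L u. x \<noteq> y \<longrightarrow> (x, y) \<in> parcs H"
      by (auto simp: L_def arcs)
    show "\<forall>(u, v)\<in>parcs G. \<forall>x\<in>L u. \<forall>y\<in>L v. \<forall>z\<in>L v.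
        (x, y) \<in> parcs H \<longrightarrow> (x, z) \<in> parcs H \<longrightarrow> y = z"
    proof -
      have "y = z" if uv: "(u, v) \<in> parcs G" and mem: "x \<in> L u" "y \<in> L v" "z \<in> L v"
        and a: "(x, y) \<in> parcs H" "(x, z) \<in> parcs H" for u v x y z
      proof -
      obtain i j l where eq: "x = (u, i)" "y = (v, j)" "z = (v, l)" and lt: "i < k" "j < k" "l < k"
        using mem by (auto simp: L_def)
      have "u \<noteq> v" using uv G.no_loops' by auto
      with a have "R u i v j" "R u i v l" unfolding eq arcs by blast+
      from functional[OF uv lt this] show "y = z" by (simp add: eq)
      qed
      then show ?thesis by blast
    qed
  qed
  have "\<forall>u\<in>pverts G. k \<le> card (L u)" by (simp add: L_def card_cartesian_product)
  from dp_colorable_cover[OF dp cov this G] obtain I where I: "cover_coloring G L H I" ..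
  have "\<exists>i. (u, i) \<in> I \<and> i < k" if "u \<in> pverts G" for u
  proof -
    have "card (I \<inter> L u) = 1" using I that by (simp add: cover_coloring_def)
    then obtain x where "I \<inter> L u = {x}" by (auto simp: card_1_singleton_iff)
    then have "x \<in> I" "x \<in> L u" by blast+
    then show ?thesis by (auto simp: L_def)
  qed
  then obtain f where f: "\<And>u. u \<in> pverts G \<Longrightarrow> (u, f u) \<in> I \<and> f u < k" by metis
  have "\<not> R u (f u) v (f v)" if uv: "(u, v) \<in> parcs G" for u v
  proof -
    note p = G.in_arcsD1[OF uv] G.in_arcsD2[OF uv]
    have "((u, f u), (v, f v)) \<notin> parcs H"
      using I f[OF p(1)] f[OF p(2)] by (auto simp: cover_coloring_def independent_set_def)
    then show ?thesis using f p uv by (auto simp: arcs)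
  qed
  then show ?thesis using f by (intro exI[of _ f]) auto
qed

text \<open>Equality of colours serves as the conflict relation \<open>R\<close>.\<close>

lemma dp_colorable_imp_proper_coloring:
  assumes "dp_colorable G k" "pair_graph G"
  shows "\<exists>c. proper_coloring G k c"
  unfolding proper_coloring_def by (rule dp_colorable_avoid_conflicts[OF assms]) auto

lemma chromatic_number_le: "proper_coloring G k c \<Longrightarrow> chromatic_number G \<le> k"
  unfolding chromatic_number_def by (rule Least_le) blast

lemma proper_coloring_chromatic_number:
  "pair_graph G \<Longrightarrow> \<exists>c. proper_coloring G (chromatic_number G) c"
  unfolding chromatic_number_def
  by (rule LeastI_ex) (blast intro: dp_colorable_imp_proper_coloring dp_colorable_card)

lemma chromatic_number_le_dp_chromatic_number:
  "pair_graph G \<Longrightarrow> chromatic_number G \<le> dp_chromatic_number G"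
  by (meson chromatic_number_le dp_colorable_dp_chromatic_number dp_colorable_imp_proper_coloring)

section \<open>Joins with complete graphs and the upper bound on \<open>Z_DP\<close>\<close>

lemma pverts_join_complete [simp]: "pverts (join_complete G s) = Inl ` pverts G \<union> Inr ` {..<s}"
  by (simp add: join_complete_def)

lemma parcs_join_complete [simp]:
  "(Inl u, Inl v) \<in> parcs (join_complete G s) \<longleftrightarrow> (u, v) \<in> parcs G"
  "(Inl u, Inr i) \<in> parcs (join_complete G s) \<longleftrightarrow> u \<in> pverts G \<and> i < s"
  "(Inr i, Inl u) \<in> parcs (join_complete G s) \<longleftrightarrow> u \<in> pverts G \<and> i < s"
  "(Inr i, Inr j) \<in> parcs (join_complete G s) \<longleftrightarrow> i < s \<and> j < s \<and> i \<noteq> j"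
  by (auto simp: join_complete_def)

text \<open>K_s takes \<open>s\<close> distinct colours that cannot occur on \<open>G\<close>;
  renumbering the others colours \<open>G\<close> with \<open>s\<close> fewer.\<close>

lemma chromatic_number_join_complete_ge:
  assumes G: "pair_graph G"
  shows "chromatic_number G + s \<le> chromatic_number (join_complete G s)"
proof -
  interpret pair_graph G by fact
  define K where "K = chromatic_number (join_complete G s)"
  obtain c where "proper_coloring (join_complete G s) K c"
    using proper_coloring_chromatic_number[OF pair_graph_join_complete[OF G]] unfolding K_def by blast
  then have lt: "\<And>v. v \<in> pverts (join_complete G s) \<Longrightarrow> c v < K"
    and ne: "\<And>u v. (u, v) \<in> parcs (join_complete G s) \<Longrightarrow> c u \<noteq> c v"
    unfolding proper_coloring_def by blast+
  define S where "S = (\<lambda>i. c (Inr i)) ` {..<s}"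
  have "inj_on (\<lambda>i. c (Inr i)) {..<s}" using ne by (intro inj_onI) (metis lessThan_iff parcs_join_complete(4))
  then have cS: "card S = s" by (simp add: S_def card_image)
  have SK: "S \<subseteq> {..<K}" using lt by (auto simp: S_def)
  then have cD: "card ({..<K} - S) = K - s" using cS by (subst card_Diff_subset) (auto simp: S_def)
  have "s \<le> K" using card_mono[OF _ SK] cS by simp
  obtain h where h: "bij_betw h ({..<K} - S) {..<K - s}"
    using finite_same_card_bij[of "{..<K} - S" "{..<K - s}"] cD by auto
  have mem: "c (Inl v) \<in> {..<K} - S" if v: "v \<in> pverts G" for v
  proof -
    have "c (Inl v) \<noteq> c (Inr i)" if "i < s" for i
      using ne[of "Inl v" "Inr i"] v that by simp
    then show ?thesis using lt[of "Inl v"] v by (auto simp: S_def)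
  qed
  have "proper_coloring G (K - s) (\<lambda>v. h (c (Inl v)))"
    unfolding proper_coloring_def
  proof (intro conjI ballI; clarify?)
    show "h (c (Inl v)) < K - s" if "v \<in> pverts G" for v using bij_betwE[OF h] mem[OF that] by auto
    fix u v assume uv: "(u, v) \<in> parcs G" "h (c (Inl u)) = h (c (Inl v))"
    have "c (Inl u) = c (Inl v)"
      using bij_betw_imp_inj_on[OF h] mem in_arcsD1[OF uv(1)] in_arcsD2[OF uv(1)] uv(2)
      by (auto dest: inj_onD)
    then show False using ne[of "Inl u" "Inl v"] uv by simp
  qed
  then show ?thesis using chromatic_number_le \<open>s \<le> K\<close> unfolding K_def by fastforce
qed

text \<open>Savings start at \<open>e = 0\<close>, where the measure is \<open>n + n * n\<close>.
  The classes come from an optimal coloring of \<open>G\<close>, so \<open>k\<close> is its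
  chromatic number.\<close>

lemma dp_colorable_join_complete:
  assumes G: "pair_graph G" and n: "card (pverts G) = n"
    and s: "2 * (n + n * n) + n * n + n + 1 \<le> s"
  shows "dp_colorable (join_complete G s) (chromatic_number G + s)"
  unfolding dp_colorable_def
proof (intro allI impI, elim conjE)
  interpret pair_graph G by fact
  fix L :: "'a + nat \<Rightarrow> nat set" and H
  assume cov: "is_cover (join_complete G s) L H"
    and k: "\<forall>u\<in>pverts (join_complete G s). chromatic_number G + s \<le> card (L u)"
  obtain c where c: "proper_coloring G (chromatic_number G) c"
    using proper_coloring_chromatic_number[OF G] ..
  have inl: "card (Inl ` pverts G :: ('a + nat) set) = n" by (simp add: card_image n)
  have inr: "card (Inr ` {..<s} :: ('a + nat) set) = s" by (simp add: card_image)
  have "\<exists>f. selection (parcs H) (Inl ` pverts G \<union> Inr ` {..<s}) L f"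
  proof (rule selection_of_long_lists[OF is_coverD(1)[OF cov], where C = "\<lambda>u. c (projl u)"
        and k = "chromatic_number G" and e = "\<lambda>_. 0" and n = n])
    show "matched (parcs H) (Inl ` pverts G \<union> Inr ` {..<s}) L" using is_coverD(2)[OF cov] by simp
    show "c (projl v) < chromatic_number G" if "v \<in> Inl ` pverts G" for v :: "'a + nat"
      using c that by (auto simp: proper_coloring_def)
    show "(x, y) \<notin> parcs H"
      if "u \<in> Inl ` pverts G" "v \<in> Inl ` pverts G" "u \<noteq> v" "c (projl u) = c (projl v)" "x \<in> L u" "y \<in> L v"
      for u v x y
      by (rule is_coverD(4)[OF cov, of u v]) (use that c in \<open>auto simp: proper_coloring_def\<close>)
    show "2 * (card (Inl ` pverts G :: ('a + nat) set) + (\<Sum>v\<in>(Inl ` pverts G :: ('a + nat) set). n - 0)) + n * n + n + 1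
        \<le> card (Inr ` {..<s} :: ('a + nat) set)"
      using s by (simp add: inl inr)
  qed (use k in \<open>auto simp: inl inr add.commute\<close>)
  then show "\<exists>I. cover_coloring (join_complete G s) L H I"
    using cover_coloring_if_selection[OF cov] by auto
qed

text \<open>Both numbers are squeezed to \<open>chromatic_number G + s\<close>. As the threshold
  depends only on \<open>n\<close>, this also bounds \<open>Z_DP\<close> uniformly.\<close>

lemma Z_DP_eventually:
  assumes G: "pair_graph G" and n: "card (pverts G) = n"
    and s: "2 * (n + n * n) + n * n + n + 1 \<le> s"
  shows "dp_chromatic_number (join_complete G s) = chromatic_number (join_complete G s)"
proof (rule antisym)
  have "dp_chromatic_number (join_complete G s) \<le> chromatic_number G + s"
    unfolding dp_chromatic_number_def by (rule Least_le) (rule dp_colorable_join_complete[OF assms])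
  also have "\<dots> \<le> chromatic_number (join_complete G s)" by (rule chromatic_number_join_complete_ge[OF G])
  finally show "dp_chromatic_number (join_complete G s) \<le> chromatic_number (join_complete G s)" .
qed (rule chromatic_number_le_dp_chromatic_number[OF pair_graph_join_complete[OF G]])

text \<open>Infinitely many graphs on \<open>nat\<close> may compete, but their \<open>Z_DP\<close>
  values are bounded in terms of \<open>n\<close>, so the set under \<open>Max\<close> is
  finite.\<close>

lemma Z_DP_le_Z_DP_max:
  fixes G :: "nat pair_pre_digraph"
  assumes "pair_graph G" "card (pverts G) = n"
  shows "Z_DP G \<le> Z_DP_max n"
  unfolding Z_DP_max_def
proof (rule Max_ge)
  have "Z_DP G \<le> 2 * (n + n * n) + n * n + n + 1"
    if "pair_graph G" "card (pverts G) = n" for G :: "nat pair_pre_digraph"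
    unfolding Z_DP_def by (rule Least_le) (rule Z_DP_eventually[OF that order_refl])
  then show "finite {Z_DP G | G :: nat pair_pre_digraph. pair_graph G \<and> card (pverts G) = n}"
    by (intro finite_subset[OF _ finite_atMost[of "2 * (n + n * n) + n * n + n + 1"]]) auto
qed (use assms in blast)

section \<open>Complete bipartite graphs and the lower bound\<close>

definition complete_bipartite :: "nat \<Rightarrow> nat \<Rightarrow> nat pair_pre_digraph" where
  "complete_bipartite m n = \<lparr>pverts = {..<m + n},
     parcs = {(u, v). u < m + n \<and> v < m + n \<and> (u < m \<longleftrightarrow> m \<le> v)}\<rparr>"

lemma pair_graph_complete_bipartite: "pair_graph (complete_bipartite m n)"
  by (rule pair_graphI) (auto simp: complete_bipartite_def)

text \<open>
  The edges at the vertices \<open>0\<close> and \<open>Suc p\<close> form a spanning tree with shift \<open>0\<close>. The other \<open>p * q\<close>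
  edges are numbered from \<open>1\<close> on, and their numbers are their shifts.
\<close>

lemma not_dp_colorable_join_complete_bipartite:
  assumes s: "s < p * q"
  shows "\<not> dp_colorable (join_complete (complete_bipartite (Suc p) (Suc q)) s) (s + 2)"
proof
  let ?J = "join_complete (complete_bipartite (Suc p) (Suc q)) s"
  define shift where "shift u v = (if u = 0 \<or> v = Suc p then 0
    else (u - 1) * q + (v - Suc (Suc p)) + 1)" for u v
  \<comment> \<open>Colours are residues mod \<open>N\<close>, the list size: K_s takes
    \<open>s\<close> of them and leaves two.\<close>
  define N where "N = s + 2"
  \<comment> \<open>The two branches describe one bipartite edge from its two ends; the shift is
    always added to the colour on the right side. All other edges carry identity matchings.\<close>
  define R where "R x i y j \<longleftrightarrow> (case (x, y) of
      (Inl u, Inl v) \<Rightarrow> if u < Suc p then i = (j + shift u v) mod N else j = (i + shift v u) mod N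
    | _ \<Rightarrow> i = j)" for x y :: "nat + nat" and i j
  have cancel: "j = l" if "(j + d) mod N = (l + d) mod N" "j < N" "l < N" for j l d
    using that
  proof (induction j l rule: linorder_wlog)
    case (le j l)
    then have "N dvd (l + d) - (j + d)" by (subst mod_eq_dvd_iff_nat[symmetric]) simp_all
    then have "N dvd l - j" by simp
    then show ?case using le dvd_imp_le[of N "l - j"] by (cases "l - j = 0") simp_all
  qed simp
  assume "dp_colorable ?J (s + 2)"
  then have dp: "dp_colorable ?J N" by (simp add: N_def)
  have "\<exists>f. (\<forall>u\<in>pverts ?J. f u < N) \<and> (\<forall>(u, v)\<in>parcs ?J. \<not> R u (f u) v (f v))"
  proof (rule dp_colorable_avoid_conflicts[OF dp pair_graph_join_complete[OF pair_graph_complete_bipartite]])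
    show "R y j x i" if "(x, y) \<in> parcs ?J" "R x i y j" for x y i j
      using that by (auto simp: R_def complete_bipartite_def split: sum.splits if_splits)
    show "j = l" if "(x, y) \<in> parcs ?J" "j < N" "l < N" "R x i y j" "R x i y l" for x y i j l
      using that by (auto simp: R_def split: sum.splits if_splits intro: cancel)
  qed
  then obtain f where lt: "\<And>x. x \<in> pverts ?J \<Longrightarrow> f x < N"
    and nR: "\<And>x y. (x, y) \<in> parcs ?J \<Longrightarrow> \<not> R x (f x) y (f y)" by blast
  define S where "S = (\<lambda>i. f (Inr i)) ` {..<s}"
  have "inj_on (\<lambda>i. f (Inr i)) {..<s}"
    using nR[of "Inr _" "Inr _"] by (intro inj_onI) (auto simp: R_def)
  then have cS: "card S = s" by (simp add: S_def card_image)
  have SN: "S \<subseteq> {..<N}" using lt by (auto simp: S_def)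
  then have "card ({..<N} - S) = 2" using cS by (subst card_Diff_subset) (auto simp: S_def N_def)
  then obtain a b where free: "{..<N} - S = {a, b}" by (meson card_2_iff)
  have two: "z = x \<or> z = y" if "x \<in> {..<N} - S" "y \<in> {..<N} - S" "z \<in> {..<N} - S" "x \<noteq> y" for x y z
    using that unfolding free by blast
  have mem: "f (Inl v) \<in> {..<N} - S" if v: "v < Suc p + Suc q" for v
  proof -
    have "f (Inl v) \<noteq> f (Inr i)" if "i < s" for i
      using nR[of "Inl v" "Inr i"] v that by (simp add: R_def complete_bipartite_def)
    then show ?thesis using lt[of "Inl v"] v by (auto simp: S_def complete_bipartite_def)
  qed
  have edge: "f (Inl u) \<noteq> (f (Inl v) + shift u v) mod N" if "u < Suc p" "Suc p \<le> v" "v < Suc p + Suc q" for u v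
    using nR[of "Inl u" "Inl v"] that by (simp add: R_def complete_bipartite_def)
  have tree: "f (Inl u) \<noteq> f (Inl v)"
    if "u < Suc p" "Suc p \<le> v" "v < Suc p + Suc q" "u = 0 \<or> v = Suc p" for u v
    using edge[OF that(1-3)] that(4) mem[of v] that by (auto simp: shift_def)
  define \<alpha> \<beta> where "\<alpha> = f (Inl 0)" and "\<beta> = f (Inl (Suc p))"
  have ab: "\<alpha> \<noteq> \<beta>" "\<alpha> < N" "\<beta> < N"
    using tree[of 0 "Suc p"] mem[of 0] mem[of "Suc p"] by (auto simp: \<alpha>_def \<beta>_def)
  \<comment> \<open>The colour is one of the two free ones, and the tree edge to
    \<open>Suc p\<close> excludes \<beta>.\<close>
  have left: "f (Inl u) = \<alpha>" if "u < Suc p" for u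
    using two[of \<alpha> \<beta> "f (Inl u)"] tree[of u "Suc p"] mem[of 0] mem[of "Suc p"] mem[of u] ab that
    by (auto simp: \<alpha>_def \<beta>_def)
  have right: "f (Inl v) = \<beta>" if "Suc p \<le> v" "v < Suc p + Suc q" for v
    using two[of \<alpha> \<beta> "f (Inl v)"] tree[of 0 v] mem[of 0] mem[of "Suc p"] mem[of v] ab that
    by (auto simp: \<alpha>_def \<beta>_def)
  \<comment> \<open>The difference \<alpha> - \<beta> mod \<open>N\<close>; adding \<open>N\<close>
    first avoids truncated subtraction.\<close>
  define d where "d = (\<alpha> + N - \<beta>) mod N"
  have d: "(\<beta> + d) mod N = \<alpha>" "d < N"
    using ab by (simp_all add: d_def mod_add_right_eq)
  then have "d \<noteq> 0" using ab by (intro notI) simp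
  \<comment> \<open>Here \<open>d - 1 \<le> s < p * q\<close>, so shift \<open>d\<close> occurs on
    an edge; dividing \<open>d - 1\<close> by \<open>q\<close> yields its endpoints.\<close>
  then have "d - 1 < p * q" using d s by (simp add: N_def)
  then have q: "q > 0" and "(d - 1) div q < p" by (auto intro: gr0I simp: less_mult_imp_div_less)
  then have "f (Inl (Suc ((d - 1) div q))) \<noteq>
      (f (Inl (Suc (Suc p) + (d - 1) mod q)) + shift (Suc ((d - 1) div q)) (Suc (Suc p) + (d - 1) mod q)) mod N"
    by (intro edge) auto
  moreover have "shift (Suc ((d - 1) div q)) (Suc (Suc p) + (d - 1) mod q) = d"
    using \<open>d \<noteq> 0\<close> by (simp add: shift_def)
  moreover have "f (Inl (Suc ((d - 1) div q))) = \<alpha>" using \<open>(d - 1) div q < p\<close> by (intro left) simp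
  moreover have "f (Inl (Suc (Suc p) + (d - 1) mod q)) = \<beta>" using q by (intro right) auto
  ultimately show False using d by simp
qed

lemma chromatic_number_join_complete_bipartite_le:
  "chromatic_number (join_complete (complete_bipartite m n) s) \<le> s + 2"
proof (rule chromatic_number_le)
  show "proper_coloring (join_complete (complete_bipartite m n) s) (s + 2)
      (case_sum (\<lambda>u. if u < m then s else Suc s) (\<lambda>i. i))"
    by (auto simp: proper_coloring_def join_complete_def complete_bipartite_def split: if_splits)
qed

text \<open>For \<open>s < p * q\<close> the DP-chromatic number exceeds \<open>s + 2\<close>, which
  bounds the chromatic number, so equality fails. At \<open>Z_DP\<close> equality holds, because it
  holds for some \<open>s\<close>.\<close>

lemma Z_DP_complete_bipartite_ge: "p * q \<le> Z_DP (complete_bipartite (Suc p) (Suc q))"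
proof (rule ccontr)
  let ?G = "complete_bipartite (Suc p) (Suc q)"
  let ?s = "Z_DP ?G"
  let ?J = "join_complete ?G ?s"
  assume "\<not> p * q \<le> ?s"
  then have no: "\<not> dp_colorable ?J (?s + 2)" by (intro not_dp_colorable_join_complete_bipartite) simp
  have "dp_chromatic_number ?J = chromatic_number ?J"
    unfolding Z_DP_def
    by (rule LeastI[of "\<lambda>s. dp_chromatic_number (join_complete ?G s) = chromatic_number (join_complete ?G s)"])
      (rule Z_DP_eventually[OF pair_graph_complete_bipartite refl order_refl])
  then show False
    using no chromatic_number_join_complete_bipartite_le dp_colorable_mono dp_colorable_dp_chromatic_number
      pair_graph_join_complete[OF pair_graph_complete_bipartite] by metis
qed

lemma Z_DP_max_ge: "(real n)\<^sup>2 / 4 - real n \<le> real (Z_DP_max n)"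
proof (cases "n < 2")
  case True
  then have "n = 0 \<or> n = 1" by auto
  then show ?thesis by auto
next
  case False
  \<comment> \<open>Balanced sides; each side gives up one vertex, \<open>0\<close> or
    \<open>Suc p\<close>, whose edges form the tree.\<close>
  define p q where "p = n div 2 - 1" and "q = n - n div 2 - 1"
  have n: "Suc p + Suc q = n" using False by (auto simp: p_def q_def)
  have "p * q \<le> Z_DP_max n"
    by (rule order.trans[OF Z_DP_complete_bipartite_ge Z_DP_le_Z_DP_max[OF pair_graph_complete_bipartite]])
      (simp add: complete_bipartite_def flip: n)
  then have "real p * real q \<le> real (Z_DP_max n)" by (simp flip: of_nat_mult)
  moreover have "q = p \<or> q = Suc p" using False unfolding p_def q_def by presburger
  \<comment> \<open>The right side exceeds the left by 1 for even \<open>n\<close> and by 3/4 for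
    odd \<open>n\<close>.\<close>
  then have "(real n)\<^sup>2 / 4 - real n \<le> real p * real q"
    using n by (auto simp: power2_eq_square field_simps simp flip: n)
  ultimately show ?thesis by linarith
qed

theorem theorem1p7:
  shows "\<exists>C::real. C > 0 \<and> (\<forall>n::nat. real (Z_DP_max n) \<ge> (real n)\<^sup>2 / 4 - C * real n)"
  using Z_DP_max_ge by (intro exI[of _ 1]) auto

end
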